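(* For any real $\lambda>1$, $\langle\{\mathrm{Ising}_2^\lambda\}\cup\mathcal{B}_0\rangle_\omega=\mathcal{I}_{\mathrm{anti}}$. For any $\lambda\in(0,1)$, $\langle\{\mathrm{Ising}_2^\lambda\}\cup\mathcal{B}_0\rangle_\omega=\mathcal{I}_{\mathrm{ferro}}$.
   Context: $\mathcal{B}_k$ is the set of functions $\{0,1\}^k\to\mathbb{R}_{\ge0}$, $\mathcal{B}=\bigcup_k\mathcal{B}_k$; $\mathcal{B}_0$ (nullary functions) is identified with $\mathbb{R}_{\ge0}$. $\mathrm{EQ}\in\mathcal{B}_2$ is the binary equality indicator. For $\mathcal{F}\subseteq\mathcal{B}$, $\langle\mathcal{F}\rangle$ is the closure of $\mathcal{F}\cup\{\mathrm{EQ}\}$ under introducing fictitious arguments, permuting arguments, pointwise product of equal-arity functions, and summing out an argument over $\{0,1\}$. A $k$-ary $f$ is a limit of $\mathcal{F}$ if there is a finite $S\subseteq\mathcal{F}$ such that for every $\epsilon>0$ some $k$-ary $f_\epsilon\in\langle S\rangle$ satisfies $\max_\mathbf{x}|f(\mathbf{x})-f_\epsilon(\mathbf{x})|<\epsilon$; $\langle\mathcal{F}\rangle_\omega$ is the closure of $\mathcal{F}\cup\{\mathrm{EQ}\}$ under the four operations and limits. $\mathrm{Ising}_2^\lambda\in\mathcal{B}_2$ takes value 1 on $(0,0),(1,1)$ and $\lambda$ on $(0,1),(1,0)$. $\mathcal{I}_{\mathrm{anti}}=\langle\{\mathrm{Ising}_2^\mu:\mu\ge1\}\cup\mathcal{B}_0\rangle_\omega$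 and $\mathcal{I}_{\mathrm{ferro}}=\langle\{\mathrm{Ising}_2^\mu:0\le\mu\le1\}\cup\mathcal{B}_0\rangle_\omega$. *)

theory Defs
  imports Complex_Main "HOL-Library.FuncSet" "HOL-Combinatorics.Permutations"
begin

abbreviation cube :: "nat \<Rightarrow> bool list set" where
  "cube k \<equiv> {x. length x = k}"

text \<open>
  A function carries its arity explicitly, so that functions of different arity are never
  identified. The functions are extensional on the cube, so equality in \<open>\<B> k\<close> is equality
  on \<open>{0,1}^k\<close>.
\<close>

type_synonym pbf = "nat \<times> (bool list \<Rightarrow> real)"

definition \<B> :: "nat \<Rightarrow> pbf set" where
  "\<B> k = {k} \<times> (cube k \<rightarrow>\<^sub>E {0..})"

definition Ising2 :: "real \<Rightarrow> pbf" where
  "Ising2 \<mu> = (2, \<lambda>x\<in>cube 2. if x ! 0 = x ! 1 then 1 else \<mu>)"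

definition EQ :: pbf where
  "EQ = (2, \<lambda>x\<in>cube 2. if x ! 0 = x ! 1 then 1 else 0)"

text \<open>
  Argument positions are counted from \<open>0\<close>. The new fictitious argument is put at position
  \<open>i \<le> k\<close> and may be any of the \<open>k + 1\<close> arguments; likewise any argument may be summed out.
\<close>

definition fictitious :: "nat \<Rightarrow> nat \<Rightarrow> (bool list \<Rightarrow> real) \<Rightarrow> pbf" where
  "fictitious i k f = (Suc k, \<lambda>x\<in>cube (Suc k). f (take i x @ drop (Suc i) x))"

definition permute_args :: "(nat \<Rightarrow> nat) \<Rightarrow> nat \<Rightarrow> (bool list \<Rightarrow> real) \<Rightarrow> pbf" where
  "permute_args \<pi> k f = (k, \<lambda>x\<in>cube k. f (permute_list \<pi> x))"

definition product :: "nat \<Rightarrow> (bool list \<Rightarrow> real) \<Rightarrow> (bool list \<Rightarrow> real) \<Rightarrow> pbf" where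
  "product k f g = (k, \<lambda>x\<in>cube k. f x * g x)"

definition sum_out :: "nat \<Rightarrow> nat \<Rightarrow> (bool list \<Rightarrow> real) \<Rightarrow> pbf" where
  "sum_out i k f = (k, \<lambda>x\<in>cube k. \<Sum>b\<in>UNIV. f (take i x @ b # drop i x))"

inductive_set clone :: "pbf set \<Rightarrow> pbf set" for F :: "pbf set" where
  base: "f \<in> F \<union> {EQ} \<Longrightarrow> f \<in> clone F"
| fictitious: "(k, f) \<in> clone F \<Longrightarrow> i \<le> k \<Longrightarrow> fictitious i k f \<in> clone F"
| permute_args: "(k, f) \<in> clone F \<Longrightarrow> \<pi> permutes {..<k} \<Longrightarrow> permute_args \<pi> k f \<in> clone F"
| product: "(k, f) \<in> clone F \<Longrightarrow> (k, g) \<in> clone F \<Longrightarrow> product k f g \<in> clone F"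
| sum_out: "(Suc k, f) \<in> clone F \<Longrightarrow> i \<le> k \<Longrightarrow> sum_out i k f \<in> clone F"

definition is_limit :: "pbf set \<Rightarrow> nat \<Rightarrow> (bool list \<Rightarrow> real) \<Rightarrow> bool" where
  "is_limit F k f \<longleftrightarrow> (k, f) \<in> \<B> k \<and>
     (\<exists>S. finite S \<and> S \<subseteq> F \<and>
       (\<forall>\<epsilon>>0. \<exists>g. (k, g) \<in> clone S \<and> (MAX x\<in>cube k. \<bar>f x - g x\<bar>) < \<epsilon>))"

lemma is_limit_mono [mono]:
  "(\<And>x. P x \<longrightarrow> Q x) \<Longrightarrow> is_limit (Collect P) k f \<longrightarrow> is_limit (Collect Q) k f"
  unfolding is_limit_def by blast

inductive_set omega_clone :: "pbf set \<Rightarrow> pbf set" for F :: "pbf set" where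
  base: "f \<in> F \<union> {EQ} \<Longrightarrow> f \<in> omega_clone F"
| fictitious: "(k, f) \<in> omega_clone F \<Longrightarrow> i \<le> k \<Longrightarrow> fictitious i k f \<in> omega_clone F"
| permute_args:
    "(k, f) \<in> omega_clone F \<Longrightarrow> \<pi> permutes {..<k} \<Longrightarrow> permute_args \<pi> k f \<in> omega_clone F"
| product:
    "(k, f) \<in> omega_clone F \<Longrightarrow> (k, g) \<in> omega_clone F \<Longrightarrow> product k f g \<in> omega_clone F"
| sum_out: "(Suc k, f) \<in> omega_clone F \<Longrightarrow> i \<le> k \<Longrightarrow> sum_out i k f \<in> omega_clone F"
| limit: "is_limit (omega_clone F) k f \<Longrightarrow> (k, f) \<in> omega_clone F"

definition I_anti :: "pbf set" where
  "I_anti = omega_clone ({Ising2 \<mu> | \<mu>. 1 \<le> \<mu>} \<union> \<B> 0)"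

definition I_ferro :: "pbf set" where
  "I_ferro = omega_clone ({Ising2 \<mu> | \<mu>. 0 \<le> \<mu> \<and> \<mu> \<le> 1} \<union> \<B> 0)"

end

(*
  Write [a, b] for the symmetric binary function with value a on equal and b on different
  arguments. Summing out the middle variable of a chain multiplies the eigenvalues a + b and
  a - b, so for 0 < \<lambda> < 1 and t = (1 - \<lambda>) / (1 + \<lambda>) the single function [1, \<lambda>] / (1 + \<lambda>)
  yields [1 + t^n, 1 - t^n] / 2 for all n. The m-th pointwise power of [1 + t^n, 1 - t^n] tends to
  [exp a, exp (-a)] when n grows and m t^n tends to a; this needs only one fixed normalising
  constant (2), as the finite set S in the definition of limits demands. Rescaling gives every
  Ising function with parameter in (0,1]. For \<lambda> > 1, a chain of two copies of [1, \<lambda>] has ratio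
  2 \<lambda> / (1 + \<lambda>^2) < 1, so the ferromagnetic functions are available, and multiplying them by powers
  of [1, \<lambda>] reaches every parameter.
*)

theory Submission
  imports Defs
begin

section \<open>Closure under the four operations and limits\<close>

lemma omega_clone_subset:
  assumes "F \<subseteq> omega_clone G"
  shows "omega_clone F \<subseteq> omega_clone G"
proof
  fix f assume "f \<in> omega_clone F"
  then show "f \<in> omega_clone G"
  proof (induction rule: omega_clone.induct)
    case (base f)
    then show ?case using assms omega_clone.base[of EQ G] by auto
  next
    \<comment> \<open>By the induction hypothesis the finite set behind the limit also lies in
      \<open>omega_clone G\<close>, so the same set and approximants witness a limit there.\<close>
    case (limit k f)
    then have "is_limit (omega_clone G) k f"
      unfolding is_limit_def by blast
    then show ?case by (rule omega_clone.limit)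
  qed (auto intro: omega_clone.intros)
qed

text \<open>Limits require approximants from the plain clone of one finite set, so constructions are
  carried out in \<open>clone S\<close> and transferred by this inclusion.\<close>

lemma clone_subset_omega_clone:
  assumes "S \<subseteq> omega_clone F"
  shows "clone S \<subseteq> omega_clone F"
proof
  fix f assume "f \<in> clone S"
  then show "f \<in> omega_clone F"
  proof (induction rule: clone.induct)
    case (base f)
    then show ?case using assms omega_clone.base[of EQ F] by auto
  qed (auto intro: omega_clone.intros)
qed

section \<open>Symmetric binary functions: pointwise products and chains\<close>

definition sym2 :: "real \<Rightarrow> real \<Rightarrow> pbf" where
  "sym2 a b = (2, \<lambda>x\<in>cube 2. if x ! 0 = x ! 1 then a else b)"

lemma Ising2_eq_sym2: "Ising2 \<mu> = sym2 1 \<mu>"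
  by (simp add: Ising2_def sym2_def)

lemma EQ_eq_sym2: "EQ = sym2 1 0"
  by (simp add: EQ_def sym2_def)

lemma sym2_mult_in_clone:
  assumes "sym2 a b \<in> clone S" "sym2 c d \<in> clone S"
  shows "sym2 (a * c) (b * d) \<in> clone S"
proof -
  have "product 2 (snd (sym2 a b)) (snd (sym2 c d)) \<in> clone S"
    using assms by (intro clone.product) (auto simp: sym2_def)
  moreover have "product 2 (snd (sym2 a b)) (snd (sym2 c d)) = sym2 (a * c) (b * d)"
    by (auto simp: product_def sym2_def fun_eq_iff)
  ultimately show ?thesis by simp
qed

text \<open>This is the product of the symmetric 2 by 2 matrices with diagonal a, c and off-diagonal
  b, d: two binary functions share a middle variable, which is summed out.\<close>

lemma sym2_convolution_in_clone:
  assumes "sym2 a b \<in> clone S" "sym2 c d \<in> clone S"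
  shows "sym2 (a * c + b * d) (a * d + b * c) \<in> clone S"
proof -
  define f where "f = snd (sym2 a b)"
  define g where "g = snd (sym2 c d)"
  \<comment> \<open>On arguments p, z, q, \<open>f'\<close> reads (p, z) and \<open>g'\<close> reads
    (z, q); position 1 holds the shared variable z.\<close>
  define f' where "f' = snd (fictitious 2 2 f)"
  define g' where "g' = snd (fictitious 0 2 g)"
  define h where "h = snd (product 3 f' g')"
  have "(2, f) \<in> clone S" "(2, g) \<in> clone S"
    using assms by (auto simp: f_def g_def sym2_def)
  then have "fictitious 2 2 f \<in> clone S" "fictitious 0 2 g \<in> clone S"
    by (auto intro: clone.fictitious)
  then have "(3, f') \<in> clone S" "(3, g') \<in> clone S"
    by (auto simp: f'_def g'_def fictitious_def numeral_3_eq_3)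
  then have "product 3 f' g' \<in> clone S" by (rule clone.product)
  then have "(Suc 2, h) \<in> clone S"
    by (simp add: h_def product_def)
  then have "sum_out 1 2 h \<in> clone S" by (rule clone.sum_out) simp
  moreover have "sum_out 1 2 h = sym2 (a * c + b * d) (a * d + b * c)"
  proof -
    have h: "h [p, z, q] = (if p = z then a else b) * (if z = q then c else d)" for p z q
      by (simp add: h_def product_def f'_def g'_def fictitious_def f_def g_def sym2_def)
    have "(\<Sum>z\<in>UNIV. h (take 1 x @ z # drop 1 x)) =
        (if x ! 0 = x ! 1 then a * c + b * d else a * d + b * c)" if x: "length x = 2" for x
    proof -
      obtain p q where "x = [p, q]"
        using x by (auto simp: length_Suc_conv numeral_2_eq_2)
      then show ?thesis by (auto simp: h UNIV_bool)
    qed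
    then show ?thesis
      by (auto simp: sum_out_def sym2_def intro!: restrict_ext)
  qed
  ultimately show ?thesis by simp
qed

lemma sym2_pow_in_clone:
  assumes "sym2 a b \<in> clone S"
  shows "sym2 (a ^ Suc m) (b ^ Suc m) \<in> clone S"
proof (induction m)
  case (Suc m)
  then show ?case using sym2_mult_in_clone[OF assms Suc] by simp
qed (use assms in simp)

text \<open>The matrix has eigenvalues 1 and t with common eigenvectors (1, 1) and (1, -1), so a
  chain of \<open>Suc n\<close> copies has eigenvalues 1 and \<open>t ^ Suc n\<close>.\<close>

lemma sym2_convolution_pow_in_clone:
  assumes "sym2 ((1 + t) / 2) ((1 - t) / 2) \<in> clone S"
  shows "sym2 ((1 + t ^ Suc n) / 2) ((1 - t ^ Suc n) / 2) \<in> clone S"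
proof (induction n)
  case (Suc n)
  have "(1 + t) / 2 * ((1 + s) / 2) + (1 - t) / 2 * ((1 - s) / 2) = (1 + t * s) / 2"
    "(1 + t) / 2 * ((1 - s) / 2) + (1 - t) / 2 * ((1 + s) / 2) = (1 - t * s) / 2" for s
    by (simp_all add: field_simps)
  then show ?case
    using sym2_convolution_in_clone[OF assms Suc] unfolding power_Suc[of t "Suc n"] by metis
qed (use assms in simp)

section \<open>Rescaling by constants and passing to limits\<close>

lemma const_sym2_in_omega_clone:
  assumes "\<B> 0 \<subseteq> omega_clone F" "0 \<le> c"
  shows "sym2 c c \<in> omega_clone F"
proof -
  have "(0, \<lambda>x\<in>cube 0. c) \<in> omega_clone F"
    using assms by (intro subsetD[OF assms(1)]) (simp add: \<B>_def PiE_iff)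
  then have "fictitious 0 0 (\<lambda>x\<in>cube 0. c) \<in> omega_clone F"
    by (rule omega_clone.fictitious) simp
  then have "(1, \<lambda>x\<in>cube 1. c) \<in> omega_clone F"
    by (simp add: fictitious_def restrict_def cong: if_cong)
  then have "fictitious 0 1 (\<lambda>x\<in>cube 1. c) \<in> omega_clone F"
    by (rule omega_clone.fictitious) simp
  moreover have "fictitious 0 1 (\<lambda>x\<in>cube 1. c) = sym2 c c"
    by (auto simp: fictitious_def sym2_def fun_eq_iff)
  ultimately show ?thesis by simp
qed

lemma sym2_mult_in_omega_clone:
  assumes "sym2 a b \<in> omega_clone F" "sym2 c d \<in> omega_clone F"
  shows "sym2 (a * c) (b * d) \<in> omega_clone F"
  using sym2_mult_in_clone[of a b "omega_clone F" c d] assms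
    clone_subset_omega_clone[of "omega_clone F" F] by (auto intro: clone.base)

lemma sym2_scale_in_omega_clone:
  assumes "\<B> 0 \<subseteq> omega_clone F" "0 \<le> c" "sym2 a b \<in> omega_clone F"
  shows "sym2 (c * a) (c * b) \<in> omega_clone F"
  using sym2_mult_in_omega_clone const_sym2_in_omega_clone assms by blast

lemma sym2_limit_in_omega_clone:
  assumes S: "finite S" "S \<subseteq> omega_clone F" "\<And>n. sym2 (a n) (b n) \<in> clone S"
    and lim: "a \<longlonglongrightarrow> A" "b \<longlonglongrightarrow> B" and nonneg: "0 \<le> A" "0 \<le> B"
  shows "sym2 A B \<in> omega_clone F"
proof -
  have "\<exists>g. (2, g) \<in> clone S \<and> (MAX x\<in>cube 2. \<bar>snd (sym2 A B) x - g x\<bar>) < \<epsilon>"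
    if "0 < \<epsilon>" for \<epsilon>
  proof -
    have "\<forall>\<^sub>F n in sequentially. \<bar>A - a n\<bar> < \<epsilon> \<and> \<bar>B - b n\<bar> < \<epsilon>"
      using tendstoD[OF lim(1) that] tendstoD[OF lim(2) that]
      by eventually_elim (auto simp: dist_real_def)
    then obtain n where n: "\<bar>A - a n\<bar> < \<epsilon>" "\<bar>B - b n\<bar> < \<epsilon>"
      by (auto simp: eventually_sequentially)
    have "finite (cube 2 :: bool list set)"
      using finite_lists_length_eq[of "UNIV :: bool set" 2] by simp
    moreover have "cube 2 \<noteq> ({} :: bool list set)"
      by (auto intro: exI[of _ "replicate 2 True"])
    ultimately have "(MAX x\<in>cube 2. \<bar>snd (sym2 A B) x - snd (sym2 (a n) (b n)) x\<bar>) < \<epsilon>"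
      using n by (subst Max_less_iff) (auto simp: sym2_def)
    moreover have "(2, snd (sym2 (a n) (b n))) \<in> clone S"
      using S(3)[of n] by (simp add: sym2_def)
    ultimately show ?thesis by blast
  qed
  moreover have "(2, snd (sym2 A B)) \<in> \<B> 2"
    using nonneg by (auto simp: \<B>_def sym2_def)
  ultimately have "is_limit (omega_clone F) 2 (snd (sym2 A B))"
    using S(1,2) unfolding is_limit_def by blast
  then have "(2, snd (sym2 A B)) \<in> omega_clone F" by (rule omega_clone.limit)
  then show ?thesis by (simp add: sym2_def)
qed

text \<open>The logarithm of the power is k x times ln (1 + x) / x, and the second factor tends to
  the derivative of ln at 1.\<close>

lemma one_plus_power_tendsto_exp:
  fixes x :: "nat \<Rightarrow> real" and k :: "nat \<Rightarrow> nat"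
  assumes x: "x \<longlonglongrightarrow> 0" "\<And>n. x n \<noteq> 0" "\<And>n. -1 < x n" and kx: "(\<lambda>n. k n * x n) \<longlonglongrightarrow> a"
  shows "(\<lambda>n. (1 + x n) ^ k n) \<longlonglongrightarrow> exp a"
proof -
  have "((\<lambda>h. ln (1 + h) / h) \<longlongrightarrow> 1) (at (0::real))"
    using DERIV_ln[of "1::real"] by (simp add: DERIV_def)
  moreover have "filterlim x (at 0) sequentially"
    using x by (auto simp: filterlim_at)
  ultimately have "(\<lambda>n. ln (1 + x n) / x n) \<longlonglongrightarrow> 1"
    by (rule filterlim_compose)
  from tendsto_mult[OF kx this] have "(\<lambda>n. k n * ln (1 + x n)) \<longlonglongrightarrow> a"
    using x(2) by simp
  then have "(\<lambda>n. exp (k n * ln (1 + x n))) \<longlonglongrightarrow> exp a"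
    by (rule tendsto_exp)
  moreover have "exp (k n * ln (1 + x n)) = (1 + x n) ^ k n" for n
    using x(3)[of n] by (simp add: exp_of_nat_mult)
  ultimately show ?thesis by simp
qed

section \<open>From one Ising parameter to all others\<close>

lemma Ising2_ferro_in_omega_clone:
  assumes B0: "\<B> 0 \<subseteq> omega_clone F" and r: "0 < r" "r < 1" "Ising2 r \<in> omega_clone F"
    and \<mu>: "0 < \<mu>" "\<mu> \<le> 1"
  shows "Ising2 \<mu> \<in> omega_clone F"
proof -
  \<comment> \<open>The ratio of the eigenvalues 1 - r and 1 + r; dividing by 1 + r turns them into
    t and 1.\<close>
  define t where "t = (1 - r) / (1 + r)"
  have t: "0 < t" "t < 1" using r by (auto simp: t_def)
  have "(1 + t) / 2 = 1 / (1 + r)" "(1 - t) / 2 = 1 / (1 + r) * r"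
    using r(1) by (auto simp: t_def field_simps)
  moreover have "sym2 (1 / (1 + r) * 1) (1 / (1 + r) * r) \<in> omega_clone F"
    using r by (intro sym2_scale_in_omega_clone[OF B0]) (auto simp: Ising2_eq_sym2)
  ultimately have h: "sym2 ((1 + t) / 2) ((1 - t) / 2) \<in> omega_clone F"
    by (metis mult.right_neutral)
  define S where "S = {sym2 ((1 + t) / 2) ((1 - t) / 2), sym2 2 2}"
  have S: "finite S" "S \<subseteq> omega_clone F"
    using h const_sym2_in_omega_clone[OF B0, of 2] by (auto simp: S_def)
  \<comment> \<open>Chosen so that exp (-a) / exp a = \<mu>; it is nonnegative because \<mu> \<le>
    1.\<close>
  define a where "a = - ln \<mu> / 2"
  have "0 \<le> a" using \<mu> by (simp add: a_def)
  \<comment> \<open>The exponent starts at 1, so x n < 1 and 1 - x n stays positive already for n =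
    0.\<close>
  define x where "x n = t ^ Suc n" for n
  \<comment> \<open>Rounding a / x n to a positive integer costs at most 1, so k n * x n differs
    from a by at most x n. The \<open>Suc\<close> matches \<open>sym2_pow_in_clone\<close>.\<close>
  define k where "k n = Suc (nat \<lfloor>a / x n\<rfloor>)" for n
  have x: "0 < x n" "x n < 1" for n
    using t power_Suc_less_one[of t n] by (auto simp: x_def)
  have x_lim: "x \<longlonglongrightarrow> 0"
    using LIMSEQ_Suc[OF LIMSEQ_realpow_zero[of t]] t by (simp add: x_def[abs_def])
  have "norm (k n * x n - a) \<le> norm (x n) * 1" for n
  proof -
    have q: "0 \<le> a / x n" using \<open>0 \<le> a\<close> x(1)[of n] by simp
    have k: "real (k n) = of_int \<lfloor>a / x n\<rfloor> + 1"
      using q by (simp add: k_def)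
    have "a / x n \<le> k n" "k n \<le> a / x n + 1"
      unfolding k by linarith+
    then show ?thesis
      using x(1)[of n] by (simp add: field_simps abs_le_iff)
  qed
  then have "(\<lambda>n. k n * x n - a) \<longlonglongrightarrow> 0"
    by (intro tendsto_0_le[OF x_lim, where K = 1]) (simp add: x less_imp_le)
  then have kx: "(\<lambda>n. k n * x n) \<longlonglongrightarrow> a" by (rule LIM_zero_cancel)
  have plus: "(\<lambda>n. (1 + x n) ^ k n) \<longlonglongrightarrow> exp a"
  proof (rule one_plus_power_tendsto_exp[OF x_lim _ _ kx])
    show "x n \<noteq> 0" "-1 < x n" for n using x[of n] by auto
  qed
  have minus: "(\<lambda>n. (1 + - x n) ^ k n) \<longlonglongrightarrow> exp (- a)"
  proof (rule one_plus_power_tendsto_exp)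
    show "(\<lambda>n. - x n) \<longlonglongrightarrow> 0" using tendsto_minus[OF x_lim] by simp
    show "(\<lambda>n. k n * - x n) \<longlonglongrightarrow> - a" using tendsto_minus[OF kx] by simp
    show "- x n \<noteq> 0" "-1 < - x n" for n using x[of n] by auto
  qed
  have "sym2 ((1 + x n) ^ k n) ((1 + - x n) ^ k n) \<in> clone S" for n
  proof -
    have "sym2 ((1 + x n) / 2) ((1 - x n) / 2) \<in> clone S"
      unfolding x_def by (rule sym2_convolution_pow_in_clone) (auto simp: S_def intro: clone.base)
    moreover have "sym2 2 2 \<in> clone S" by (auto simp: S_def intro: clone.base)
    ultimately have "sym2 ((1 + x n) / 2 * 2) ((1 - x n) / 2 * 2) \<in> clone S"
      by (rule sym2_mult_in_clone)
    moreover have "y / 2 * 2 = y" for y :: real by simp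
    ultimately have "sym2 (1 + x n) (1 + - x n) \<in> clone S" by (simp only: diff_conv_add_uminus)
    then show ?thesis unfolding k_def by (rule sym2_pow_in_clone)
  qed
  then have "sym2 (exp a) (exp (- a)) \<in> omega_clone F"
    by (rule sym2_limit_in_omega_clone[OF S _ plus minus]) auto
  \<comment> \<open>Scaling by exp (-a) makes the diagonal value 1 and the other exp (-2 a) =
    \<mu>.\<close>
  then have "sym2 (exp (- a) * exp a) (exp (- a) * exp (- a)) \<in> omega_clone F"
    by (intro sym2_scale_in_omega_clone[OF B0]) auto
  moreover have "exp (- a) * exp a = 1" "exp (- a) * exp (- a) = \<mu>"
    using \<mu> by (simp_all add: a_def flip: exp_add)
  ultimately show ?thesis by (simp add: Ising2_eq_sym2)
qed

lemma Ising2_anti_in_omega_clone: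
  assumes B0: "\<B> 0 \<subseteq> omega_clone F" and r: "1 < r" "Ising2 r \<in> omega_clone F"
    and \<mu>: "0 < \<mu>"
  shows "Ising2 \<mu> \<in> omega_clone F"
proof -
  have *: "sym2 1 r \<in> clone {sym2 1 r}" by (auto intro: clone.base)
  have sub: "clone {sym2 1 r} \<subseteq> omega_clone F"
    using r(2) by (intro clone_subset_omega_clone) (simp add: Ising2_eq_sym2)
  \<comment> \<open>Squaring the matrix makes its negative eigenvalue 1 - r positive, hence the
    result is ferromagnetic.\<close>
  have "sym2 (1 + r\<^sup>2) (2 * r) \<in> omega_clone F"
    using sym2_convolution_in_clone[OF * *] sub by (auto simp: power2_eq_square)
  then have "sym2 (1 / (1 + r\<^sup>2) * (1 + r\<^sup>2)) (1 / (1 + r\<^sup>2) * (2 * r)) \<in> omega_clone F"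
    by (intro sym2_scale_in_omega_clone[OF B0]) auto
  moreover have "0 < 1 + r\<^sup>2" by (simp add: add_pos_nonneg)
  ultimately have ferro: "Ising2 (2 * r / (1 + r\<^sup>2)) \<in> omega_clone F"
    by (simp add: Ising2_eq_sym2)
  have "0 < (r - 1)\<^sup>2" using r(1) by simp
  then have "2 * r < 1 + r\<^sup>2" by (simp add: power2_diff)
  with r(1) \<open>0 < 1 + r\<^sup>2\<close> have ratio: "0 < 2 * r / (1 + r\<^sup>2)" "2 * r / (1 + r\<^sup>2) < 1"
    by simp_all
  \<comment> \<open>A power of r exceeding \<mu> brings the quotient into (0,1), where the
    ferromagnetic case applies; the pointwise power of \<open>Ising2 r\<close> then restores the
    factor.\<close>
  obtain n where "\<mu> < r ^ n" using real_arch_pow[OF r(1)] by blast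
  also have "\<dots> \<le> r ^ Suc n" using r(1) by (intro power_increasing) auto
  finally have n: "\<mu> < r ^ Suc n" .
  have pos: "0 < r ^ Suc n" using r(1) by (intro zero_less_power) simp
  have "Ising2 (\<mu> / r ^ Suc n) \<in> omega_clone F"
    using n pos \<mu> by (intro Ising2_ferro_in_omega_clone[OF B0 ratio ferro])
      (auto simp del: power_Suc)
  moreover have "sym2 (1 ^ Suc n) (r ^ Suc n) \<in> omega_clone F"
    using sym2_pow_in_clone[OF *] sub by blast
  ultimately have "sym2 (1 * 1 ^ Suc n) (\<mu> / r ^ Suc n * r ^ Suc n) \<in> omega_clone F"
    unfolding Ising2_eq_sym2 by (rule sym2_mult_in_omega_clone)
  then show ?thesis using pos r(1) by (simp add: Ising2_eq_sym2)
qed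

theorem theorem3p2:
  "(\<forall>\<mu>::real. 1 < \<mu> \<longrightarrow> omega_clone ({Ising2 \<mu>} \<union> \<B> 0) = I_anti) \<and>
   (\<forall>\<mu>::real. 0 < \<mu> \<and> \<mu> < 1 \<longrightarrow> omega_clone ({Ising2 \<mu>} \<union> \<B> 0) = I_ferro)"
proof (intro conjI allI impI)
  fix \<mu> :: real assume \<mu>: "1 < \<mu>"
  let ?C = "omega_clone ({Ising2 \<mu>} \<union> \<B> 0)"
  have B0: "\<B> 0 \<subseteq> ?C" and "Ising2 \<mu> \<in> ?C" by (auto intro: omega_clone.base)
  then have "{Ising2 \<nu> | \<nu>. 1 \<le> \<nu>} \<subseteq> ?C"
    using Ising2_anti_in_omega_clone[OF B0 \<mu>] by auto
  then have "I_anti \<subseteq> ?C"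
    unfolding I_anti_def using B0 by (intro omega_clone_subset) auto
  moreover have "?C \<subseteq> I_anti"
    unfolding I_anti_def using \<mu> by (intro omega_clone_subset) (auto intro!: omega_clone.base)
  ultimately show "?C = I_anti" by simp
next
  fix \<mu> :: real assume \<mu>: "0 < \<mu> \<and> \<mu> < 1"
  let ?C = "omega_clone ({Ising2 \<mu>} \<union> \<B> 0)"
  have B0: "\<B> 0 \<subseteq> ?C" and mem: "Ising2 \<mu> \<in> ?C" by (auto intro: omega_clone.base)
  have "Ising2 \<nu> \<in> ?C" if "0 \<le> \<nu>" "\<nu> \<le> 1" for \<nu>
  proof (cases "\<nu> = 0")
    \<comment> \<open>The limit construction uses ln \<nu> and so covers positive parameters; at 0
      the Ising function is \<open>EQ\<close>.\<close>
    case True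
    then have "Ising2 \<nu> = EQ" by (simp add: Ising2_eq_sym2 EQ_eq_sym2)
    then show ?thesis by (auto intro: omega_clone.base)
  next
    case False
    then show ?thesis using Ising2_ferro_in_omega_clone[OF B0 _ _ mem, of \<nu>] \<mu> that by simp
  qed
  then have "I_ferro \<subseteq> ?C"
    unfolding I_ferro_def using B0 by (intro omega_clone_subset) auto
  moreover have "?C \<subseteq> I_ferro"
    unfolding I_ferro_def using \<mu> by (intro omega_clone_subset) (auto intro!: omega_clone.base)
  ultimately show "?C = I_ferro" by simp
qed

end
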